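(* Let $q,z\in\mathbb{C}$ with $0<|q|<1$, $z\ne0$ and $z\ne1$. Then $$\sum_{n=0}^\infty\frac{(-1/z,-z)_n}{(q)_{2n}}q^{n(n+1)}=\frac{1}{(1-z)(q)_\infty}\Big((-q^2/z,-zq,q^3;q^3)_\infty-z(-q/z,-zq^2,q^3;q^3)_\infty\Big),$$ $$\sum_{n=0}^\infty\frac{(-1/z,-z)_n}{(q)_n(q;q^2)_n}q^{\binom{n+1}{2}}=\frac{(-q)_\infty}{(q)_\infty}(-q/z,-zq,q^2;q^2)_\infty,$$ $$\sum_{n=0}^\infty\frac{(-1)^n(-1/z,-z)_n}{(-q)_n(q;q^2)_n}q^{\binom{n+1}{2}}=\frac{1}{1-z}\Big(\sum_{n=0}^{\infty}-\sum_{n=-\infty}^{-1}\Big)(-1)^{n+1}q^{n^2}(1-q^{2n+1})z^{n+1}.$$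
   Context: $(a;p)_n=\prod_{j=1}^{n}(1-ap^{j-1})$ for $n\ge0$ (with $(a;p)_0=1$), $(a;p)_\infty=\prod_{j\ge0}(1-ap^j)$, $(a_1,\dots,a_m;p)_n=\prod_i(a_i;p)_n$ and likewise with $n=\infty$; when the base is omitted it is $q$. Here $(-1)^n$ and $(-1)^{n+1}$ are ordinary powers. The notation $\big(\sum_{n\ge0}-\sum_{n\le-1}\big)c_n$ means $\sum_{n\ge0}c_n-\sum_{n\le-1}c_n$. *)

theory Defs
  imports "HOL-Analysis.Analysis"
begin

definition qpoch :: "complex \<Rightarrow> complex \<Rightarrow> nat \<Rightarrow> complex" where
  "qpoch a p n = (\<Prod>j=1..n. 1 - a * p ^ (j - 1))"

text \<open>
  The value is meant for \<open>norm p < 1\<close>.  Vanishing factors are harmless: the library's notion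
  of convergent product allows finitely many of them, and then \<^const>\<open>prodinf\<close> is \<open>0\<close>.
\<close>
definition qpoch_inf :: "complex \<Rightarrow> complex \<Rightarrow> complex" where
  "qpoch_inf a p = (\<Prod>j. 1 - a * p ^ j)"

text \<open>The multi-parameter symbols \<open>(a\<^sub>1, \<dots>, a\<^sub>m; p)\<^sub>n\<close> and \<open>(a\<^sub>1, \<dots>, a\<^sub>m; p)\<^sub>\<infinity>\<close>.\<close>

definition qpochs :: "complex list \<Rightarrow> complex \<Rightarrow> nat \<Rightarrow> complex" where
  "qpochs as p n = (\<Prod>a\<leftarrow>as. qpoch a p n)"

definition qpochs_inf :: "complex list \<Rightarrow> complex \<Rightarrow> complex" where
  "qpochs_inf as p = (\<Prod>a\<leftarrow>as. qpoch_inf a p)"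

text \<open>
  The signed bilateral sum \<open>(\<Sum>n\<ge>0 - \<Sum>n\<le>-1) c n\<close>.  Since \<^const>\<open>infsum\<close> is \<open>0\<close> for families
  that are not summable, this is meaningful only if both halves are summable.
\<close>

definition signed_summable :: "(int \<Rightarrow> complex) \<Rightarrow> bool" where
  "signed_summable c \<longleftrightarrow> c summable_on {0..} \<and> c summable_on {..-1}"

definition signed_sum :: "(int \<Rightarrow> complex) \<Rightarrow> complex" where
  "signed_sum c = (\<Sum>\<^sub>\<infinity>n\<in>{0..}. c n) - (\<Sum>\<^sub>\<infinity>n\<in>{..-1}. c n)"

lemma convergent_prod_qpoch_inf:
  fixes a p :: complex
  assumes "norm p < 1"
  shows "convergent_prod (\<lambda>j. 1 - a * p ^ j)"
proof -
  have "summable (\<lambda>j. norm a * norm p ^ j)"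
    using assms by (intro summable_mult summable_geometric) auto
  then have "abs_convergent_prod (\<lambda>j. 1 - a * p ^ j)"
    by (simp add: abs_convergent_prod_conv_summable norm_mult norm_power)
  then show ?thesis
    by (rule abs_convergent_prod_imp_convergent_prod)
qed

end

theory Submission
  imports Defs
begin

text \<open>
  Multiplied by \<open>1 - z\<close>, the quotient \<open>(-1/z, -z)\<^sub>n / (q)\<^sub>2\<^sub>n\<close> becomes a Laurent polynomial in \<open>z\<close>
  whose coefficient of \<open>z\<^sup>r\<^sup>+\<^sup>1\<close> is a theta weight times
  \<open>1 / ((q)\<^sub>n\<^sub>-\<^sub>r (q)\<^sub>n\<^sub>+\<^sub>r\<^sub>+\<^sub>1)\<close>: a Bailey pair relative to \<open>a = q\<close>.  Each of the three sums weights this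
  quotient by \<open>\<Prod>j=1..n. q\<^sup>j (q\<^sup>j - e)\<close> with \<open>e = 0, -1, 1\<close> respectively.  After interchanging the
  summations, the inner sum over \<open>n\<close> is a summable \<open>\<^sub>1\<phi>\<^sub>1\<close> series, and what remains is a theta series
  in \<open>r\<close>.  The Jacobi triple product turns it into infinite products for \<open>e = 0, -1\<close>; for \<open>e = 1\<close>
  the symmetry \<open>r \<mapsto> -r-1\<close> of the inner sum disagrees with the sign \<open>(-1)\<^sup>r\<close>, which makes the
  theta series partial.
\<close>

section \<open>Finite and infinite q-shifted factorials\<close>

lemma qpoch_0 [simp]: "qpoch a p 0 = 1"
  by (simp add: qpoch_def)

lemma qpoch_Suc: "qpoch a p (Suc n) = qpoch a p n * (1 - a * p ^ n)"
  by (simp add: qpoch_def)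

lemma qpoch_lessThan: "qpoch a p n = (\<Prod>j<n. 1 - a * p ^ j)"
  by (induction n) (simp_all add: qpoch_Suc)

lemma qpoch_nonzero:
  assumes "norm p < 1" "norm a < 1"
  shows "qpoch a p n \<noteq> 0"
proof -
  have "norm (a * p ^ j) < 1" for j
  proof -
    have "norm (a * p ^ j) \<le> norm a * 1"
      unfolding norm_mult norm_power
      by (intro mult_left_mono power_le_one) (use assms in auto)
    thus ?thesis using assms by simp
  qed
  hence "1 - a * p ^ j \<noteq> 0" for j
    by (metis eq_iff_diff_eq_0 less_irrefl norm_one)
  thus ?thesis by (simp add: qpoch_lessThan)
qed

lemma qpoch_inf_nonzero:
  assumes "norm p < 1" "norm a < 1"
  shows "qpoch_inf a p \<noteq> 0"
proof -
  have "1 - a * p ^ j \<noteq> 0" for j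
    using qpoch_nonzero[OF assms, of "Suc j"] by (simp add: qpoch_Suc)
  thus ?thesis
    unfolding qpoch_inf_def by (intro prodinf_nonzero convergent_prod_qpoch_inf assms)
qed

lemma qpoch_tendsto:
  assumes "norm p < 1"
  shows "(\<lambda>n. qpoch a p n) \<longlonglongrightarrow> qpoch_inf a p"
proof -
  have "(\<lambda>n. \<Prod>j\<le>n. 1 - a * p ^ j) \<longlonglongrightarrow> qpoch_inf a p"
    unfolding qpoch_inf_def by (rule convergent_prod_LIMSEQ[OF convergent_prod_qpoch_inf[OF assms]])
  hence "(\<lambda>n. qpoch a p (Suc n)) \<longlonglongrightarrow> qpoch_inf a p"
    by (simp add: qpoch_lessThan lessThan_Suc_atMost)
  thus ?thesis by (simp add: filterlim_sequentially_Suc)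
qed

lemma qpoch_add: "qpoch a p (m + n) = qpoch a p m * qpoch (a * p ^ m) p n"
  by (induction n) (simp_all add: qpoch_Suc power_add mult_ac)

lemma qpoch_inf_split:
  assumes "norm p < 1"
  shows "qpoch_inf a p = qpoch a p n * qpoch_inf (a * p ^ n) p"
proof (rule LIMSEQ_unique)
  show "(\<lambda>k. qpoch a p (k + n)) \<longlonglongrightarrow> qpoch_inf a p"
    by (rule LIMSEQ_ignore_initial_segment[OF qpoch_tendsto[OF assms]])
  show "(\<lambda>k. qpoch a p (k + n)) \<longlonglongrightarrow> qpoch a p n * qpoch_inf (a * p ^ n) p"
    unfolding add.commute[of _ n] qpoch_add by (intro tendsto_intros qpoch_tendsto assms)
qed

text \<open>The factors of (q)_(2n) with odd exponent form (q;q^2)_n, and those with even exponent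
  split by 1 - x^2 = (1 - x)(1 + x). This turns the denominator of the Bailey pair into the
  denominators of the second and third sums.\<close>

lemma qpoch_double: "qpoch q q (2 * n) = qpoch q q n * qpoch (- q) q n * qpoch q (q ^ 2) n"
proof (induction n)
  case (Suc n)
  have "(q ^ 2) ^ n = q ^ n * q ^ n"
    by (simp add: power_mult [symmetric] mult_2 power_add)
  moreover have "q ^ (2 * n) = q ^ n * q ^ n"
    by (simp add: mult_2 power_add)
  ultimately have "qpoch q q (2 * Suc n) = qpoch q q (2 * n) * ((1 - q * (q ^ n * q ^ n)) *
      ((1 - q * q ^ n) * (1 + q * q ^ n)))" 
    and "qpoch q (q ^ 2) (Suc n) = qpoch q (q ^ 2) n * (1 - q * (q ^ n * q ^ n))"
    by (simp_all add: qpoch_Suc algebra_simps)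
  thus ?case
    by (simp only: Suc qpoch_Suc) (simp add: mult_ac)
qed simp

section \<open>Limits and rearrangements of unordered sums\<close>

text \<open>Tannery's theorem, obtained as dominated convergence for the counting measure. It
  carries the two passages to the limit: in the finite triple product and in the iteration of the
  1phi1 recurrence.\<close>

lemma infsum_tendsto_dominated:
  fixes s :: "nat \<Rightarrow> 'a \<Rightarrow> 'b::{banach, second_countable_topology}"
  assumes lim: "\<And>x. x \<in> A \<Longrightarrow> (\<lambda>k. s k x) \<longlonglongrightarrow> f x"
    and bound: "\<And>k x. x \<in> A \<Longrightarrow> norm (s k x) \<le> w x"
    and w: "w summable_on A"
  shows "f summable_on A" and "(\<lambda>k. infsum (s k) A) \<longlonglongrightarrow> infsum f A"
proof -
  have fw: "norm (f x) \<le> w x" if "x \<in> A" for x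
    by (rule LIMSEQ_le_const2[OF tendsto_norm[OF lim[OF that]]]) (simp add: bound that)
  have wi: "integrable (count_space A) w"
    unfolding abs_summable_on_def[symmetric]
    using w summable_on_iff_abs_summable_on_real abs_summable_equivalent by blast
  have si: "(\<lambda>x. norm (s k x)) summable_on A" for k
    by (rule summable_on_comparison_test[OF w]) (use bound in auto)
  have fi: "(\<lambda>x. norm (f x)) summable_on A"
    by (rule summable_on_comparison_test[OF w]) (use fw in auto)
  show "f summable_on A" using fi by (rule abs_summable_summable)
  have "(\<lambda>k. integral\<^sup>L (count_space A) (s k)) \<longlonglongrightarrow> integral\<^sup>L (count_space A) f"
    by (rule integral_dominated_convergence[where w = w])
      (use wi lim bound in \<open>auto simp: AE_count_space\<close>)
  thus "(\<lambda>k. infsum (s k) A) \<longlonglongrightarrow> infsum f A"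
    using infsetsum_infsum[OF si[THEN abs_summable_equivalent[THEN iffD1]]]
      infsetsum_infsum[OF fi[THEN abs_summable_equivalent[THEN iffD1]]]
    by (simp add: infsetsum_def)
qed

lemma has_sum_diff:
  fixes f g :: "'a \<Rightarrow> 'b::topological_ab_group_add"
  assumes "(f has_sum a) A" "(g has_sum b) A"
  shows "((\<lambda>x. f x - g x) has_sum (a - b)) A"
  using has_sum_add[OF assms(1) has_sum_uminus[THEN iffD2], of g "- b"] assms(2) by simp

lemma has_sum_int_shift:
  fixes f :: "int \<Rightarrow> 'a::{comm_monoid_add, topological_space}"
  assumes "(f has_sum S) UNIV"
  shows "((\<lambda>j. f (j + c)) has_sum S) UNIV"
  using assms has_sum_reindex_bij_witness[of UNIV "\<lambda>j. j - c" "\<lambda>j. j + c" UNIV f "\<lambda>j. f (j + c)" S]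
  by simp

section \<open>Triangular exponents and convergence of theta series\<close>

text \<open>The binomial coefficient C(j,2) continued to negative \<open>j\<close>. The division is
  exact, and the value is invariant under replacing \<open>j\<close> by
  \<open>1 - j\<close>.\<close>

definition tri :: "int \<Rightarrow> int" where
  "tri j = j * (j - 1) div 2"

lemma two_tri: "2 * tri j = j * (j - 1)"
  unfolding tri_def by simp

lemma tri_add1: "tri (j + 1) = tri j + j"
  using two_tri[of j] two_tri[of "j + 1"] by (simp add: algebra_simps)

lemma tri_diff1: "tri (j - 1) = tri j - j + 1"
  using tri_add1[of "j - 1"] by simp

text \<open>The ratio \<open>p ^ n * c\<close> of consecutive terms tends to 0 however large
  \<open>c\<close> is. The terms, c^n p^(n(n-1)/2) in closed form, are the common majorant for theta
  series, 1phi1 series and the weights \<open>delta\<close>.\<close>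

lemma summable_prod_power:
  fixes p c :: real
  assumes "0 \<le> p" "p < 1" "0 \<le> c"
  shows "summable (\<lambda>n. \<Prod>j<n. p ^ j * c)"
proof -
  have "(\<lambda>n. p ^ n * c) \<longlonglongrightarrow> 0 * c"
    by (intro tendsto_intros LIMSEQ_realpow_zero assms)
  hence "eventually (\<lambda>n. p ^ n * c < 1 / 2) sequentially"
    by (rule order_tendstoD) simp
  then obtain N where N: "\<And>n. n \<ge> N \<Longrightarrow> p ^ n * c < 1 / 2"
    unfolding eventually_sequentially by blast
  show ?thesis
  proof (rule summable_ratio_test[where c = "1/2" and N = N])
    fix n assume "n \<ge> N"
    have P: "0 \<le> (\<Prod>j<n. p ^ j * c)" by (intro prod_nonneg) (use assms in auto)
    hence "(\<Prod>j<n. p ^ j * c) * (p ^ n * c) \<le> (\<Prod>j<n. p ^ j * c) * (1 / 2)"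
      using N[OF \<open>n \<ge> N\<close>] by (intro mult_left_mono) auto
    thus "norm (\<Prod>j<Suc n. p ^ j * c) \<le> 1 / 2 * norm (\<Prod>j<n. p ^ j * c)"
      using P assms by (simp add: abs_mult)
  qed simp
qed

lemma summable_on_prod_power:
  fixes p c :: real
  assumes "0 \<le> p" "p < 1" "0 \<le> c"
  shows "(\<lambda>n. \<Prod>j<n. p ^ j * c) summable_on UNIV"
  using summable_prod_power[OF assms]
  by (rule summable_nonneg_imp_summable_on) (use assms in \<open>auto intro!: prod_nonneg\<close>)

lemma powi_tri_nat: "(p :: 'a::field) powi tri (int n) * c powi int n = (\<Prod>j<n. p ^ j * c)"
  if "p \<noteq> 0"
proof (induction n)
  case (Suc n)
  have "tri (int (Suc n)) = tri (int n) + int n"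
    using tri_add1[of "int n"] by (simp add: add.commute)
  thus ?case using that Suc by (simp add: power_int_add algebra_simps)
qed (simp add: tri_def)

lemma theta_abs_summable:
  fixes q z :: complex
  assumes "q \<noteq> 0" "norm q < 1" "z \<noteq> 0"
  shows "(\<lambda>j. norm (q powi tri j * z powi j)) summable_on UNIV"
proof -
  define p where "p = norm q"
  have p: "p \<noteq> 0" "0 \<le> p" "p < 1" using assms by (auto simp: p_def)
  have half: "(\<lambda>j. p powi tri j * c powi j) summable_on {0..}" if "0 \<le> c" for c :: real
  proof -
    have "(\<lambda>n. p powi tri (int n) * c powi int n) summable_on (UNIV :: nat set)"
      unfolding powi_tri_nat[OF p(1)] by (rule summable_on_prod_power) (use p that in auto)
    moreover have "bij_betw int UNIV {0..}"
      by (rule bij_betwI[where g = nat]) auto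
    ultimately show ?thesis
      using summable_on_reindex_bij_betw[of int UNIV "{0..}" "\<lambda>j. p powi tri j * c powi j"] by simp
  qed
  define c where "c = norm z"
  have c: "c \<noteq> 0" "c > 0" using assms by (auto simp: c_def)
  have 1: "(\<lambda>j. p powi tri j * c powi j) summable_on {0..}"
    using half[of c] c by simp
  \<comment> \<open>The negative half is reflected by \<open>j\<close> to \<open>1 - j\<close>,
    which fixes \<open>tri\<close> and maps \<open>{..-1}\<close> onto \<open>{2..}\<close>. The
    extra factor \<open>c\<close> arises because c^(1-j) = c (1/c)^j.\<close>
  have "(\<lambda>j. p powi tri j * (1 / c) powi j * c) summable_on {2..}"
    by (intro summable_on_cmult_left summable_on_subset_banach[OF half]) (use c in auto)
  also have "(\<lambda>j. p powi tri j * (1 / c) powi j * c) summable_on {2..} \<longleftrightarrow>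
      (\<lambda>j. p powi tri j * c powi j) summable_on {..-1}"
    (is "?f summable_on _ \<longleftrightarrow> ?g summable_on _")
  proof (rule summable_on_reindex_bij_witness[where i = "\<lambda>j. 1 - j" and j = "\<lambda>j. 1 - j"])
    fix j :: int
    have "tri (1 - j) = tri j" by (simp add: tri_def algebra_simps)
    thus "?g (1 - j) = ?f j" 
      using c by (simp add: power_int_diff field_simps)
  qed auto
  finally have 2: "(\<lambda>j. p powi tri j * c powi j) summable_on {..-1}" .
  have "(\<lambda>j. p powi tri j * c powi j) summable_on ({0..} \<union> {..-1})"
    by (rule summable_on_union[OF 1 2])
  also have "{0..} \<union> {..-1} = (UNIV :: int set)" by auto
  finally show ?thesis by (simp add: norm_mult norm_power_int p_def c_def)
qed

section \<open>Reciprocals of (q)_k for integer k\<close>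

context
  fixes q :: complex
  assumes q0: "q \<noteq> 0" and q1: "norm q < 1"
begin

text \<open>The value 0 at negative \<open>k\<close> is the usual convention for 1/(q)_k. It gives
  the bilateral sums below finite support and makes \<open>rq_rec\<close> valid for every
  integer.\<close>

definition rq :: "int \<Rightarrow> complex" where
  "rq k = (if k < 0 then 0 else 1 / qpoch q q (nat k))"

lemma rq_neg [simp]: "k < 0 \<Longrightarrow> rq k = 0"
  by (simp add: rq_def)

lemma rq_0 [simp]: "rq 0 = 1"
  by (simp add: rq_def)

lemma rq_of_nat: "rq (int n) = 1 / qpoch q q n"
  by (simp add: rq_def)

lemma one_minus_power_nonzero: "1 - q * q ^ n \<noteq> 0"
  using qpoch_nonzero[OF q1 q1, of "Suc n"] by (simp add: qpoch_Suc)

text \<open>At \<open>k = 0\<close> the factor \<open>1 - q powi k\<close> vanishes, in agreement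
  with \<open>rq (-1) = 0\<close>. Hence the termwise inductions below need no boundary
  cases.\<close>

lemma rq_rec: "rq (k - 1) = (1 - q powi k) * rq k"
proof (cases "k \<le> 0")
  case True
  thus ?thesis by (cases "k = 0") auto
next
  case False
  define n where "n = nat (k - 1)"
  have k: "k = int (Suc n)" using False by (simp add: n_def)
  have "q powi k = q * q ^ n" by (simp only: k power_int_of_nat power_Suc)
  moreover have "rq (k - 1) = 1 / qpoch q q n" by (simp add: k rq_of_nat)
  ultimately show ?thesis
    using one_minus_power_nonzero[of n] qpoch_nonzero[OF q1 q1]
    by (simp only: k rq_of_nat qpoch_Suc) (simp add: field_simps)
qed

lemma rq_tendsto: "(\<lambda>n. rq (int n + c)) \<longlonglongrightarrow> 1 / qpoch_inf q q"
proof -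
  have l: "(\<lambda>n. 1 / qpoch q q n) \<longlonglongrightarrow> 1 / qpoch_inf q q"
    by (intro tendsto_intros qpoch_tendsto qpoch_inf_nonzero q1)
  have "filterlim (\<lambda>n. nat (int n + c)) at_top sequentially"
    unfolding filterlim_at_top eventually_sequentially
  proof
    fix Z show "\<exists>N. \<forall>n\<ge>N. Z \<le> nat (int n + c)"
      by (rule exI[of _ "nat (int Z - c)"]) auto
  qed
  hence "(\<lambda>n. 1 / qpoch q q (nat (int n + c))) \<longlonglongrightarrow> 1 / qpoch_inf q q"
    by (rule filterlim_compose[OF l])
  moreover have "eventually (\<lambda>n. 1 / qpoch q q (nat (int n + c)) = rq (int n + c)) sequentially"
    unfolding eventually_sequentially
    by (rule exI[of _ "nat (- c)"]) (auto simp: rq_def)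
  ultimately show ?thesis by (rule Lim_transform_eventually)
qed

lemma rq_bounded: obtains B where "B \<ge> 0" "\<And>k. norm (rq k) \<le> B"
proof -
  have "Bseq (\<lambda>n. rq (int n))"
    using rq_tendsto[of 0] by (intro convergent_imp_Bseq) (auto simp: convergent_def)
  then obtain B where B: "B > 0" "\<And>n. norm (rq (int n)) \<le> B"
    by (auto simp: Bseq_def)
  have "norm (rq k) \<le> B" for k
    using B(1) B(2)[of "nat k"] by (cases "k < 0") auto
  thus ?thesis using that[of B] B(1) by simp
qed

lemma powi_tri_shift:
  "q powi tri (j + 1) = q powi tri j * q powi j"
  "q powi tri (j - 1) = q powi tri j * q / q powi j"
  using q0 by (simp_all add: tri_add1 tri_diff1 power_int_add power_int_diff)

section \<open>The Jacobi triple product, finite and infinite\<close>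

lemma qpoch_double_Suc:
  "qpoch q q (2 * Suc n) = qpoch q q (2 * n) * ((1 - q * (q ^ n) ^ 2) * (1 - q ^ 2 * (q ^ n) ^ 2))"
proof -
  have "q ^ (2 * n) = (q ^ n) ^ 2"
    by (simp add: power_mult [symmetric] mult.commute)
  thus ?thesis by (simp add: qpoch_Suc power2_eq_square mult_ac)
qed

lemma qpoch_double_factor_nonzero: "(1 - q * (q ^ n) ^ 2) * (1 - q ^ 2 * (q ^ n) ^ 2) \<noteq> 0"
  using qpoch_nonzero[OF q1 q1, of "2 * Suc n"] unfolding qpoch_double_Suc by simp

text \<open>Induction on \<open>n\<close>: with \<open>Q = q ^ n\<close>, the right side gains the
  factor (1 + zQ)(1 + qQ/z)/c. Expanding the numerator as (1 + qQ^2) + zQ + qQ/z combines the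
  coefficients at \<open>j\<close>, \<open>j - 1\<close> and \<open>j + 1\<close>, so that the step
  becomes one identity for each \<open>j\<close>.\<close>

lemma finite_jacobi_triple:
  assumes "z \<noteq> 0"
  shows "((\<lambda>j. q powi tri j * z powi j * (rq (int n - j) * rq (int n + j))) has_sum
     (qpoch (- z) q n * qpoch (- q / z) q n / qpoch q q (2 * n))) UNIV"
proof (induction n)
  case 0
  show ?case
    by (rule has_sum_finite_neutralI[where B = "{0}"]) (auto simp: tri_def rq_def)
next
  case (Suc n)
  define f where "f n j = q powi tri j * z powi j * (rq (int n - j) * rq (int n + j))" for n j
  define Q where "Q = q ^ n"
  define S where "S = qpoch (- z) q n * qpoch (- q / z) q n / qpoch q q (2 * n)"
  define c where "c = (1 - q * Q ^ 2) * (1 - q ^ 2 * Q ^ 2)"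
  have c0: "c \<noteq> 0" unfolding c_def Q_def by (rule qpoch_double_factor_nonzero)
  have f: "(f n has_sum S) UNIV"
    using Suc by (simp add: f_def[abs_def] S_def)
  have "((\<lambda>j. (1 + q * Q ^ 2) * f n j + z * Q * f n (j + (- 1)) + q * Q / z * f n (j + 1)) has_sum
      ((1 + q * Q ^ 2) * S + z * Q * S + q * Q / z * S)) UNIV"
    by (intro has_sum_add has_sum_cmult_right has_sum_int_shift f)
  also have "(\<lambda>j. (1 + q * Q ^ 2) * f n j + z * Q * f n (j + (- 1)) + q * Q / z * f n (j + 1)) =
      (\<lambda>j. c * f (Suc n) j)"
  proof
    fix j
    define X where "X = q powi j"
    have X0: "X \<noteq> 0" using q0 by (simp add: X_def)
    \<comment> \<open>The two reciprocals at level \<open>Suc n\<close>; by \<open>rq_rec\<close>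
      those occurring at level \<open>n\<close> are multiples of them.\<close>
    define a where "a = rq (int n + 1 - j)"
    define b where "b = rq (int n + 1 + j)"
    have pw: "q powi (int n + 1 - j) = q * Q / X" "q powi (int n + 1 + j) = q * Q * X"
      "q powi (int n - j) = Q / X" "q powi (int n + j) = Q * X"
      using q0 by (simp_all add: power_int_add power_int_diff X_def Q_def)
    have r: "rq (int n - j) = (1 - q * Q / X) * a" "rq (int n + j) = (1 - q * Q * X) * b"
      using rq_rec[of "int n + 1 - j"] rq_rec[of "int n + 1 + j"]
      by (simp_all add: a_def b_def pw)
    have r': "rq (int n - j - 1) = (1 - Q / X) * ((1 - q * Q / X) * a)"
      "rq (int n + j - 1) = (1 - Q * X) * ((1 - q * Q * X) * b)"
      using rq_rec[of "int n - j"] rq_rec[of "int n + j"] by (simp_all add: r pw)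
    define w where "w = q powi tri j * z powi j * (a * b)"
    have e0: "f n j = w * ((1 - q * Q / X) * (1 - q * Q * X))"
      by (simp add: f_def r w_def mult_ac)
    have "rq (int n - (j + 1)) = rq (int n - j - 1)" "rq (int n + (j + 1)) = b"
      "rq (int n - (j - 1)) = a" "rq (int n + (j - 1)) = rq (int n + j - 1)"
      by (simp_all add: a_def b_def algebra_simps)
    note r'' = this[unfolded r']
    have e1: "f n (j + 1) = w * (X * z) * ((1 - Q / X) * (1 - q * Q / X))"
      using assms by (simp only: f_def r'' powi_tri_shift) (simp add: X_def w_def power_int_add mult_ac)
    have e2: "f n (j + (- 1)) = w * (q / (X * z)) * ((1 - Q * X) * (1 - q * Q * X))"
      using assms by (simp only: add_uminus_conv_diff f_def r'' powi_tri_shift)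
        (simp add: X_def w_def power_int_diff mult_ac)
    have e3: "f (Suc n) j = w"
      by (simp add: f_def w_def a_def b_def algebra_simps)
    have "(1 + q * Q ^ 2) * f n j + z * Q * f n (j + (- 1)) + q * Q / z * f n (j + 1) =
      w * ((1 + q * Q ^ 2) * ((1 - q * Q / X) * (1 - q * Q * X))
        + Q * (q / X) * ((1 - Q * X) * (1 - q * Q * X)) + q * Q * X * ((1 - Q / X) * (1 - q * Q / X)))"
      unfolding e0 e1 e2 using assms by (simp add: distrib_left mult_ac)
    also have "\<dots> = w * c"
    proof (rule arg_cong[of _ _ "\<lambda>u. w * u"])
      \<comment> \<open>With \<open>Y\<close> for the inverse of \<open>X\<close>, what remains is a
        polynomial identity modulo \<open>X * Y = 1\<close>.\<close>
      define Y where "Y = 1 / X"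
      have XY: "X * Y = 1" "X * (Y * u) = u" for u using X0 by (simp_all add: Y_def)
      have "(1 + q * Q ^ 2) * ((1 - q * Q * Y) * (1 - q * Q * X))
        + Q * (q * Y) * ((1 - Q * X) * (1 - q * Q * X)) + q * Q * X * ((1 - Q * Y) * (1 - q * Q * Y)) =
        (1 - q * Q ^ 2) * (1 - q ^ 2 * Q ^ 2)"
        by (simp add: algebra_simps power2_eq_square XY)
      thus "(1 + q * Q ^ 2) * ((1 - q * Q / X) * (1 - q * Q * X))
        + Q * (q / X) * ((1 - Q * X) * (1 - q * Q * X)) + q * Q * X * ((1 - Q / X) * (1 - q * Q / X)) = c"
        by (simp add: Y_def c_def)
    qed
    finally show "(1 + q * Q ^ 2) * f n j + z * Q * f n (j + (- 1)) + q * Q / z * f n (j + 1) =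
        c * f (Suc n) j"
      by (simp add: e3)
  qed
  finally have "(f (Suc n) has_sum (((1 + q * Q ^ 2) * S + z * Q * S + q * Q / z * S) / c)) UNIV"
    using c0 by (subst (asm) has_sum_cmult_right_iff) auto
  moreover have "((1 + q * Q ^ 2) * S + z * Q * S + q * Q / z * S) / c = S * ((1 + z * Q) * (1 + q * Q / z)) / c"
    using assms by (simp add: field_simps power2_eq_square)
  moreover have "qpoch (- z) q (Suc n) * qpoch (- q / z) q (Suc n) / qpoch q q (2 * Suc n) =
      S * ((1 + z * Q) * (1 + q * Q / z)) / c"
    unfolding qpoch_double_Suc c_def[unfolded Q_def, symmetric]
    by (simp add: S_def qpoch_Suc Q_def c_def)
  ultimately have "(f (Suc n) has_sum
      qpoch (- z) q (Suc n) * qpoch (- q / z) q (Suc n) / qpoch q q (2 * Suc n)) UNIV"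
    by (simp only:)
  thus ?case by (simp only: f_def[abs_def])
qed

text \<open>The limit of the finite form. Both reciprocals tend to 1/(q)_\<infinity>, giving its
  square on the left against a single one on the right, and their boundedness makes the theta series
  itself a majorant.\<close>

lemma jacobi_triple:
  assumes "z \<noteq> 0"
  shows "((\<lambda>j. q powi tri j * z powi j) has_sum
    (qpoch_inf (- z) q * qpoch_inf (- q / z) q * qpoch_inf q q)) UNIV"
proof -
  obtain B where B: "B \<ge> 0" "\<And>k. norm (rq k) \<le> B" using rq_bounded by blast
  define P where "P = qpoch_inf q q"
  have P0: "P \<noteq> 0" unfolding P_def by (rule qpoch_inf_nonzero[OF q1 q1])
  define g where "g j = q powi tri j * z powi j" for j
  have g: "(\<lambda>j. norm (g j)) summable_on UNIV"
    unfolding g_def by (rule theta_abs_summable[OF q0 q1 assms])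
  have lim: "(\<lambda>n. g j * (rq (int n - j) * rq (int n + j))) \<longlonglongrightarrow> g j * (1 / P * (1 / P))" for j
    using rq_tendsto[of "- j"] rq_tendsto[of j] by (intro tendsto_intros) (simp_all add: P_def)
  have bound: "norm (g j * (rq (int n - j) * rq (int n + j))) \<le> norm (g j) * (B * B)" for n j
    unfolding norm_mult by (intro mult_left_mono mult_mono B) auto
  note * = infsum_tendsto_dominated[OF lim bound summable_on_cmult_left[OF g]]
  have "infsum (\<lambda>j. g j * (rq (int n - j) * rq (int n + j))) UNIV =
      qpoch (- z) q n * qpoch (- q / z) q n / qpoch q q (2 * n)" for n
    unfolding g_def by (rule infsumI[OF finite_jacobi_triple[OF assms]])
  hence "(\<lambda>n. qpoch (- z) q n * qpoch (- q / z) q n / qpoch q q (2 * n)) \<longlonglongrightarrow>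
      infsum (\<lambda>j. g j * (1 / P * (1 / P))) UNIV"
    using *(2) by simp
  moreover have "(\<lambda>n. qpoch (- z) q n * qpoch (- q / z) q n / qpoch q q (2 * n)) \<longlonglongrightarrow>
      qpoch_inf (- z) q * qpoch_inf (- q / z) q / P"
  proof -
    have "(\<lambda>n. qpoch q q (2 * n)) \<longlonglongrightarrow> P"
      unfolding P_def using LIMSEQ_subseq_LIMSEQ[OF qpoch_tendsto[OF q1], of "\<lambda>n. 2 * n" q]
      by (simp add: strict_mono_def o_def)
    thus ?thesis by (intro tendsto_intros qpoch_tendsto q1 P0)
  qed
  ultimately have "infsum (\<lambda>j. g j * (1 / P * (1 / P))) UNIV =
      qpoch_inf (- z) q * qpoch_inf (- q / z) q / P"
    by (rule LIMSEQ_unique)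
  hence "((\<lambda>j. g j * (1 / P * (1 / P))) has_sum
      (qpoch_inf (- z) q * qpoch_inf (- q / z) q / P)) UNIV"
    using *(1) by (simp add: has_sum_iff)
  from has_sum_cmult_left[OF this, of "P * P"] show ?thesis
    using P0 by (simp add: g_def P_def mult.assoc)
qed

section \<open>The Bailey pair relative to a = q\<close>

definition pair_coeff :: "complex \<Rightarrow> int \<Rightarrow> complex" where
  "pair_coeff z r = - (q powi tri r * (1 - q powi (2 * r + 1)) * z powi (r + 1))"

text \<open>For 0 \<le> r this is Bailey's kernel 1/((q)_(n-r) (aq)_(n+r)) at a = q, divided by
  \<open>1 - q\<close>. In this normalization it makes sense for all integers \<open>r\<close> and
  vanishes unless -n-1 \<le> r \<le> n.\<close>

definition pair_kernel :: "nat \<Rightarrow> int \<Rightarrow> complex" where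
  "pair_kernel n r = rq (int n - r) * rq (int n + r + 1)"

text \<open>
  A Bailey pair relative to \<open>a = q\<close>: \<open>\<beta>\<^sub>n = (1 - z) (-z, -1/z)\<^sub>n / (q)\<^sub>2\<^sub>n\<close>, with the
  contributions of \<open>r\<close> and \<open>-r-1\<close> to \<open>\<alpha>\<^sub>r\<close> kept apart.
\<close>

lemma bailey_pair:
  assumes "z \<noteq> 0"
  shows "((\<lambda>r. pair_coeff z r * pair_kernel n r) has_sum
     ((1 - z) * (qpoch (- 1 / z) q n * qpoch (- z) q n) / qpoch q q (2 * n))) UNIV"
proof (induction n)
  case 0
  have "1 - q \<noteq> 0"
    using one_minus_power_nonzero[of 0] by simp
  hence r1: "rq 1 * (1 - q) = 1"
    using rq_of_nat[of 1] by (simp add: qpoch_Suc)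
  \<comment> \<open>For \<open>n = 0\<close> only these two indices survive. Both have kernel
    \<open>rq 1\<close>, with coefficients -z(1 - q) and 1 - q.\<close>
  have "(\<Sum>r\<in>{0, -1}. pair_coeff z r * pair_kernel 0 r) = (rq 1 * (1 - q)) * (1 - z)"
    using q0 by (simp add: pair_coeff_def pair_kernel_def tri_def algebra_simps)
  hence "(\<Sum>r\<in>{0, -1}. pair_coeff z r * pair_kernel 0 r) = 1 - z"
    by (simp only: r1 mult_1)
  moreover have "pair_kernel 0 r = 0" if "r \<notin> {0, -1}" for r
    using that by (cases "r > 0") (auto simp: pair_kernel_def)
  ultimately show ?case
    by (intro has_sum_finite_neutralI[where B = "{0, -1}"]) auto
next
  case (Suc n)
  define f where "f n j = pair_coeff z j * pair_kernel n j" for n j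
  define Q where "Q = q ^ n"
  define S where "S = (1 - z) * (qpoch (- 1 / z) q n * qpoch (- z) q n) / qpoch q q (2 * n)"
  define c where "c = (1 - q * Q ^ 2) * (1 - q ^ 2 * Q ^ 2)"
  have c0: "c \<noteq> 0" unfolding c_def Q_def by (rule qpoch_double_factor_nonzero)
  have f: "(f n has_sum S) UNIV"
    using Suc by (simp add: f_def[abs_def] S_def)
  \<comment> \<open>The weights come from (1 + zQ)(1 + Q/z), the new numerator factors. As in the
    finite triple product, the induction step reduces to an identity for each
    \<open>j\<close>.\<close>
  have "((\<lambda>j. (1 + Q ^ 2) * f n j + z * Q * f n (j + (- 1)) + Q / z * f n (j + 1)) has_sum
      ((1 + Q ^ 2) * S + z * Q * S + Q / z * S)) UNIV"
    by (intro has_sum_add has_sum_cmult_right has_sum_int_shift f)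
  also have "(\<lambda>j. (1 + Q ^ 2) * f n j + z * Q * f n (j + (- 1)) + Q / z * f n (j + 1)) =
      (\<lambda>j. c * f (Suc n) j)"
  proof
    fix j
    define X where "X = q powi j"
    have X0: "X \<noteq> 0" using q0 by (simp add: X_def)
    define a where "a = rq (int n + 1 - j)"
    define b where "b = rq (int n + 2 + j)"
    have pw: "q powi (int n + 1 - j) = q * Q / X" "q powi (int n + 2 + j) = q ^ 2 * Q * X"
      "q powi (int n - j) = Q / X" "q powi (int n + 1 + j) = q * Q * X"
      using q0 by (simp_all add: power_int_add power_int_diff X_def Q_def)
    have r: "rq (int n - j) = (1 - q * Q / X) * a" "rq (int n + 1 + j) = (1 - q ^ 2 * Q * X) * b"
    proof -
      have "int n + 1 - j - 1 = int n - j" "int n + 2 + j - 1 = int n + 1 + j"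
        by simp_all
      thus "rq (int n - j) = (1 - q * Q / X) * a" "rq (int n + 1 + j) = (1 - q ^ 2 * Q * X) * b"
        using rq_rec[of "int n + 1 - j"] rq_rec[of "int n + 2 + j"]
        by (simp_all only: a_def b_def pw)
    qed
    have r': "rq (int n - j - 1) = (1 - Q / X) * ((1 - q * Q / X) * a)"
      "rq (int n + j) = (1 - q * Q * X) * ((1 - q ^ 2 * Q * X) * b)"
      using rq_rec[of "int n - j"] rq_rec[of "int n + 1 + j"] by (simp_all add: r pw)
    have k: "pair_kernel n j = (1 - q * Q / X) * (1 - q ^ 2 * Q * X) * (a * b)"
      "pair_kernel n (j + 1) = (1 - Q / X) * (1 - q * Q / X) * (a * b)"
      "pair_kernel n (j - 1) = (1 - q * Q * X) * (1 - q ^ 2 * Q * X) * (a * b)"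
      "pair_kernel (Suc n) j = a * b"
    proof -
      have "pair_kernel n j = rq (int n - j) * rq (int n + 1 + j)"
        "pair_kernel n (j + 1) = rq (int n - j - 1) * b"
        "pair_kernel n (j - 1) = a * rq (int n + j)"
        "pair_kernel (Suc n) j = a * b"
        by (simp_all add: pair_kernel_def a_def b_def algebra_simps)
      thus "pair_kernel n j = (1 - q * Q / X) * (1 - q ^ 2 * Q * X) * (a * b)"
        "pair_kernel n (j + 1) = (1 - Q / X) * (1 - q * Q / X) * (a * b)"
        "pair_kernel n (j - 1) = (1 - q * Q * X) * (1 - q ^ 2 * Q * X) * (a * b)"
        "pair_kernel (Suc n) j = a * b"
        by (simp_all only: r r' mult_ac)
    qed
    define Y where "Y = 1 / X"
    have XY: "X * Y = 1" "X * (Y * u) = u" for u using X0 by (simp_all add: Y_def)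
    define t where "t = q powi tri j * z powi (j + 1)"
    have pq: "q powi (2 * j + 1) = q * X ^ 2" "q powi (2 * (j + 1) + 1) = q ^ 3 * X ^ 2"
      "q powi (2 * (j - 1) + 1) = X ^ 2 / q"
    proof -
      have X2: "q powi (2 * j) = X ^ 2"
        using power_int_mult[of q j 2] by (simp add: X_def mult.commute)
      have i: "2 * (j + 1) + 1 = 2 * j + 3" "2 * (j - 1) + 1 = 2 * j - 1"
        by simp_all
      show "q powi (2 * j + 1) = q * X ^ 2"
        using q0 power_int_add[of q "2 * j" 1] by (simp add: X2)
      show "q powi (2 * (j + 1) + 1) = q ^ 3 * X ^ 2"
        unfolding i using q0 power_int_add[of q "2 * j" 3] by (simp add: X2)
      show "q powi (2 * (j - 1) + 1) = X ^ 2 / q"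
        unfolding i using q0 power_int_diff[of q "2 * j" 1] by (simp add: X2)
    qed
    have pz: "z powi (j + 1 + 1) = z powi (j + 1) * z" "z powi (j - 1 + 1) = z powi (j + 1) / z"
      using assms by (simp_all add: power_int_add power2_eq_square)
    have e: "pair_coeff z j = - (t * (1 - q * X ^ 2))"
      "pair_coeff z (j + 1) = - (t * z * X * (1 - q ^ 3 * X ^ 2))"
      "pair_coeff z (j - 1) = - (t / z * Y * (q - X ^ 2))"
      unfolding pair_coeff_def pq pz powi_tri_shift
      using q0 assms by (simp_all add: t_def X_def Y_def field_simps)
    have "(1 + Q ^ 2) * f n j + z * Q * f n (j + (- 1)) + Q / z * f n (j + 1) =
      - (t * a * b) * ((1 + Q ^ 2) * ((1 - q * X ^ 2) * (1 - q * Q * Y) * (1 - q ^ 2 * Q * X))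
        + Q * (Y * (q - X ^ 2) * ((1 - q * Q * X) * (1 - q ^ 2 * Q * X))
        + X * (1 - q ^ 3 * X ^ 2) * ((1 - Q * Y) * (1 - q * Q * Y))))"
      unfolding f_def add_uminus_conv_diff e k using assms by (simp add: Y_def distrib_left mult_ac)
    also have "\<dots> = - (t * a * b) * (c * (1 - q * X ^ 2))"
      unfolding c_def
      by (intro arg_cong[of _ _ "\<lambda>u. - (t * a * b) * u"])
        (simp add: algebra_simps power2_eq_square power3_eq_cube XY)
    also have "\<dots> = c * f (Suc n) j"
      unfolding f_def k e by (simp add: mult_ac)
    finally show "(1 + Q ^ 2) * f n j + z * Q * f n (j + (- 1)) + Q / z * f n (j + 1) =
        c * f (Suc n) j" .
  qed
  finally have "(f (Suc n) has_sum (((1 + Q ^ 2) * S + z * Q * S + Q / z * S) / c)) UNIV"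
    using c0 by (subst (asm) has_sum_cmult_right_iff) auto
  moreover have "((1 + Q ^ 2) * S + z * Q * S + Q / z * S) / c = S * ((1 + z * Q) * (1 + Q / z)) / c"
    using assms by (simp add: field_simps power2_eq_square)
  moreover have "(1 - z) * (qpoch (- 1 / z) q (Suc n) * qpoch (- z) q (Suc n)) / qpoch q q (2 * Suc n) =
      S * ((1 + z * Q) * (1 + Q / z)) / c"
    unfolding qpoch_double_Suc c_def[unfolded Q_def, symmetric]
    by (simp add: S_def qpoch_Suc Q_def c_def)
  ultimately have "(f (Suc n) has_sum
      ((1 - z) * (qpoch (- 1 / z) q (Suc n) * qpoch (- z) q (Suc n)) / qpoch q q (2 * Suc n))) UNIV"
    by (simp only:)
  thus ?case by (simp only: f_def[abs_def])
qed

section \<open>A summable 1phi1 series\<close>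

text \<open>For D \<noteq> 0 this is (-D)^m q^(m(m-1)/2) (q^(N+1)/D)_m. Clearing the denominators
  admits D = 0, which is what \<open>e = 0\<close> leads to.\<close>

definition shift_prod :: "nat \<Rightarrow> complex \<Rightarrow> nat \<Rightarrow> complex" where
  "shift_prod N D m = (\<Prod>j<m. q ^ j * (q ^ (N + 1 + j) - D))"

text \<open>Since (q)_(N+m) = (q)_N (q^(N+1))_m, for D \<noteq> 0 this is the m-th term of
  1phi1(q^(N+1)/D; q^(N+1); q, D) divided by (q)_N.\<close>

definition phi11_term :: "nat \<Rightarrow> complex \<Rightarrow> nat \<Rightarrow> complex" where
  "phi11_term N D m = shift_prod N D m * rq (int m) * rq (int (N + m))"

lemma shift_prod_bound:
  assumes "norm D \<le> d"
  shows "norm (shift_prod N D m) \<le> (\<Prod>j<m. norm q ^ j * (1 + d))"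
  unfolding shift_prod_def prod_norm[symmetric] norm_mult norm_power
proof (intro prod_mono conjI mult_left_mono)
  fix j
  have "norm (q ^ (N + 1 + j) - D) \<le> norm (q ^ (N + 1 + j)) + norm D"
    by (rule norm_triangle_ineq4)
  moreover have "norm (q ^ (N + 1 + j)) \<le> 1"
    unfolding norm_power by (rule power_le_one) (use q1 in auto)
  ultimately show "norm (q ^ (N + 1 + j) - D) \<le> 1 + d"
    using assms by simp
qed auto

text \<open>The bound is uniform in \<open>N\<close> and in all \<open>D\<close> of norm at most
  \<open>d\<close>, so that one majorant serves the whole iteration in
  \<open>phi11_sum\<close>.\<close>

lemma phi11_term_bounded:
  obtains B where "B \<ge> 0" "\<And>N D d m. norm D \<le> d \<Longrightarrow>
    norm (phi11_term N D m) \<le> (\<Prod>j<m. norm q ^ j * (1 + d)) * (B * B)"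
proof -
  obtain B where B: "B \<ge> 0" "\<And>k. norm (rq k) \<le> B" using rq_bounded by blast
  have "norm (phi11_term N D m) \<le> (\<Prod>j<m. norm q ^ j * (1 + d)) * (B * B)" if "norm D \<le> d" for N D d m
  proof -
    have "0 \<le> d" using that norm_ge_zero order_trans by blast
    thus ?thesis
      unfolding phi11_term_def norm_mult mult.assoc
      by (intro mult_mono B shift_prod_bound that prod_nonneg) (auto intro: B)
  qed
  thus ?thesis using that[of B] B(1) by blast
qed

lemma phi11_term_summable: "phi11_term N D summable_on UNIV"
proof -
  obtain B where B: "B \<ge> 0" "\<And>N D d m. norm D \<le> d \<Longrightarrow>
    norm (phi11_term N D m) \<le> (\<Prod>j<m. norm q ^ j * (1 + d)) * (B * B)"
    using phi11_term_bounded by blast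
  have "(\<lambda>m. (\<Prod>j<m. norm q ^ j * (1 + norm D)) * (B * B)) summable_on UNIV"
    by (intro summable_on_cmult_left summable_on_prod_power) (use q1 in auto)
  hence "(\<lambda>m. norm (phi11_term N D m)) summable_on UNIV"
    by (rule summable_on_comparison_test) (use B in auto)
  thus ?thesis by (rule abs_summable_summable)
qed

text \<open>A contiguous relation proved by telescoping: the difference of the two m-th terms is
  \<open>U m - U (Suc m)\<close>, where \<open>U 0 = 0\<close> and \<open>U\<close> tends to
  0.\<close>

lemma phi11_step:
  "infsum (phi11_term N D) UNIV = (1 - D) * infsum (phi11_term (Suc N) (D * q)) UNIV"
proof -
  \<comment> \<open>This is \<open>(1 - q ^ m) * phi11_term N D m\<close>, written with
    \<open>rq (int m - 1)\<close> so that it vanishes at \<open>m = 0\<close>.\<close>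
  define U where "U m = shift_prod N D m * rq (int m - 1) * rq (int (N + m))" for m
  have shift: "shift_prod (Suc N) (D * q) m = q ^ m * shift_prod N D m" for m
  proof -
    have "shift_prod (Suc N) (D * q) m = (\<Prod>j<m. q * (q ^ j * (q ^ (N + 1 + j) - D)))"
      unfolding shift_prod_def by (intro prod.cong) (simp_all add: algebra_simps)
    thus ?thesis by (simp add: prod.distrib shift_prod_def)
  qed
  have tele: "phi11_term N D m - (1 - D) * phi11_term (Suc N) (D * q) m = U m - U (Suc m)" for m
  proof -
    define a where "a = rq (int m)"
    define b where "b = rq (int (N + m) + 1)"
    define P where "P = shift_prod N D m"
    have 1: "rq (int m - 1) = (1 - q ^ m) * a"
      using rq_rec[of "int m"] by (simp add: a_def)
    have 2: "rq (int (N + m)) = (1 - q * q ^ N * q ^ m) * b"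
    proof -
      have "q powi (int (N + m) + 1) = q * q ^ N * q ^ m"
        using q0 by (simp add: power_int_add power_add)
      thus ?thesis using rq_rec[of "int (N + m) + 1"] by (simp add: b_def)
    qed
    have 3: "rq (int (N + Suc m)) = b" "rq (int (Suc N + m)) = b" "rq (int (Suc m) - 1) = a"
      by (simp_all add: a_def b_def algebra_simps)
    have 4: "shift_prod N D (Suc m) = P * (q ^ m * (q * q ^ N * q ^ m - D))"
      by (simp add: shift_prod_def P_def power_add mult_ac)
    show ?thesis
      unfolding U_def phi11_term_def shift 1 2 3 4 P_def[symmetric] a_def[symmetric]
      by (simp add: algebra_simps)
  qed
  obtain B where B: "B \<ge> 0" "\<And>k. norm (rq k) \<le> B" using rq_bounded by blast
  have Ub: "norm (U m) \<le> (\<Prod>j<m. norm q ^ j * (1 + norm D)) * (B * B)" for m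
    unfolding U_def norm_mult mult.assoc
    by (intro mult_mono B shift_prod_bound prod_nonneg) (auto intro: B)
  have U0: "U \<longlonglongrightarrow> 0"
  proof (rule Lim_null_comparison)
    show "eventually (\<lambda>m. norm (U m) \<le> (\<Prod>j<m. norm q ^ j * (1 + norm D)) * (B * B)) sequentially"
      using Ub by simp
    have "(\<lambda>m. \<Prod>j<m. norm q ^ j * (1 + norm D)) \<longlonglongrightarrow> 0"
      by (intro summable_LIMSEQ_zero summable_prod_power) (use q1 in auto)
    thus "(\<lambda>m. (\<Prod>j<m. norm q ^ j * (1 + norm D)) * (B * B)) \<longlonglongrightarrow> 0"
      by (rule tendsto_mult_left_zero)
  qed
  have "(\<lambda>m. U m - U (Suc m)) sums (U 0 - 0)"
    by (rule telescope_sums'[OF U0])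
  moreover have hs: "phi11_term N' D' sums infsum (phi11_term N' D') UNIV" for N' D'
    by (rule has_sum_imp_sums[OF has_sum_infsum[OF phi11_term_summable]])
  moreover have "U 0 = 0" by (simp add: U_def)
  moreover have "(\<lambda>m. phi11_term N D m - (1 - D) * phi11_term (Suc N) (D * q) m) sums
      (infsum (phi11_term N D) UNIV - (1 - D) * infsum (phi11_term (Suc N) (D * q)) UNIV)"
    by (intro sums_diff sums_mult hs)
  ultimately show ?thesis
    using sums_unique2 by (fastforce simp: tele)
qed

text \<open>
  The case $c = q^{N+1}$ of the summation
  ${}_1\phi_1(c/D; c; q, D) = (D;q)_\infty / (c;q)_\infty$.  Moving \<open>(N, D)\<close> to
  \<open>(N + 1, D q)\<close> indefinitely leaves only the first term of the series.
\<close>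

lemma phi11_sum:
  "(phi11_term N D has_sum (qpoch_inf D q / qpoch_inf q q)) UNIV"
proof -
  have iter: "infsum (phi11_term N D) UNIV = qpoch D q k * infsum (phi11_term (N + k) (D * q ^ k)) UNIV" for k
  proof (induction k)
    case (Suc k)
    show ?case
      unfolding Suc phi11_step[of "N + k" "D * q ^ k"] by (simp add: qpoch_Suc mult_ac)
  qed simp
  obtain B where B: "B \<ge> 0" "\<And>N D d m. norm D \<le> d \<Longrightarrow>
    norm (phi11_term N D m) \<le> (\<Prod>j<m. norm q ^ j * (1 + d)) * (B * B)"
    using phi11_term_bounded by blast
  \<comment> \<open>The termwise limit, kept unsimplified to display the limit of each factor. Every
    factor of the product is 0, so only the empty product at \<open>m = 0\<close>
    contributes.\<close>
  define h where "h m = (\<Prod>j<m. q ^ j * (0 - D * 0)) * rq (int m) * (1 / qpoch_inf q q)" for m :: nat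
  have qk: "(\<lambda>k. q ^ k) \<longlonglongrightarrow> 0" using q1 by (rule LIMSEQ_power_zero)
  have lim: "(\<lambda>k. phi11_term (N + k) (D * q ^ k) m) \<longlonglongrightarrow> h m" for m
    unfolding phi11_term_def h_def shift_prod_def
  proof -
    have p: "(\<lambda>k. q ^ (N + k + 1 + i)) \<longlonglongrightarrow> 0" for i
      using LIMSEQ_ignore_initial_segment[OF qk, of "N + 1 + i"] by (simp add: add_ac)
    have r: "(\<lambda>k. rq (int (N + k + m))) \<longlonglongrightarrow> 1 / qpoch_inf q q"
      using rq_tendsto[of "int (N + m)"] by (simp add: add_ac)
    show "(\<lambda>k. (\<Prod>j<m. q ^ j * (q ^ (N + k + 1 + j) - D * q ^ k)) * rq (int m) * rq (int (N + k + m)))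
        \<longlonglongrightarrow> (\<Prod>j<m. q ^ j * (0 - D * 0)) * rq (int m) * (1 / qpoch_inf q q)"
      by (intro tendsto_mult tendsto_prod tendsto_diff tendsto_const p r qk)
  qed
  have bound: "norm (phi11_term (N + k) (D * q ^ k) m) \<le> (\<Prod>j<m. norm q ^ j * (1 + norm D)) * (B * B)" for k m
  proof (rule B(2))
    show "norm (D * q ^ k) \<le> norm D"
      unfolding norm_mult norm_power by (intro mult_left_le power_le_one) (use q1 in auto)
  qed
  have "(\<lambda>m. (\<Prod>j<m. norm q ^ j * (1 + norm D)) * (B * B)) summable_on UNIV"
    by (intro summable_on_cmult_left summable_on_prod_power) (use q1 in auto)
  from infsum_tendsto_dominated(2)[OF lim bound this]
  have "(\<lambda>k. infsum (phi11_term (N + k) (D * q ^ k)) UNIV) \<longlonglongrightarrow> infsum h UNIV" .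
  also have "infsum h UNIV = 1 / qpoch_inf q q"
  proof (rule infsumI, rule has_sum_finite_neutralI[where B = "{0}"])
    show "h m = 0" if "m \<in> UNIV - {0}" for m
      using that by (auto simp: h_def prod_zero_iff)
  qed (auto simp: h_def)
  finally have "(\<lambda>k. qpoch D q k * infsum (phi11_term (N + k) (D * q ^ k)) UNIV) \<longlonglongrightarrow>
      qpoch_inf D q * (1 / qpoch_inf q q)"
    by (intro tendsto_mult qpoch_tendsto q1)
  hence "infsum (phi11_term N D) UNIV = qpoch_inf D q * (1 / qpoch_inf q q)"
    unfolding iter[symmetric] by (simp add: LIMSEQ_const_iff)
  thus ?thesis
    using phi11_term_summable by (simp add: has_sum_iff)
qed

section \<open>Weighted sums of the kernel over n\<close>

text \<open>The values \<open>e = 0, -1, 1\<close> give the weights of the three sums of the theorem.\<close>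

definition delta :: "complex \<Rightarrow> nat \<Rightarrow> complex" where
  "delta e n = (\<Prod>j<n. q ^ (j + 1) * (q ^ (j + 1) - e))"

text \<open>In the factors beyond the first \<open>r\<close>, moving q^(r+1) from the power to the
  bracket gives q^(r+j+1) (q^(r+j+1) - e) = q^j (q^(2r+2+j) - e q^(r+1)). This is where
  \<open>N = 2 * r + 1\<close> and \<open>D = e * q ^ (r + 1)\<close> come from.\<close>

lemma delta_add: "delta e (r + m) = delta e r * shift_prod (2 * r + 1) (e * q ^ (r + 1)) m"
proof (induction m)
  case (Suc m)
  have "q ^ (r + m + 1) * (q ^ (r + m + 1) - e) =
      q ^ m * (q ^ (2 * r + 1 + 1 + m) - e * q ^ (r + 1))"
    by (simp add: algebra_simps power_add power_mult power2_eq_square)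
  thus ?case
    using Suc by (simp add: delta_def shift_prod_def mult_ac)
qed (simp add: shift_prod_def)

text \<open>The terms with \<open>n < r\<close> vanish, and \<open>n = r + m\<close> turns the
  others into the 1phi1 series. In Bailey's terms the value is, up to normalization, the \<gamma>_r
  conjugate to \<delta>_n = \<open>delta e n\<close>.\<close>

lemma pair_kernel_sum_nat:
  "((\<lambda>n. delta e n * pair_kernel n (int r)) has_sum
    (delta e r * qpoch_inf (e * q ^ (r + 1)) q / qpoch_inf q q)) UNIV"
proof -
  define D where "D = e * q ^ (r + 1)"
  have "((\<lambda>m. delta e r * phi11_term (2 * r + 1) D m) has_sum
      (delta e r * (qpoch_inf D q / qpoch_inf q q))) UNIV"
    by (intro has_sum_cmult_right phi11_sum)
  also have "(\<lambda>m. delta e r * phi11_term (2 * r + 1) D m) =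
      (\<lambda>n. delta e n * pair_kernel n (int r)) \<circ> (\<lambda>m. r + m)"
  proof
    fix m
    have "pair_kernel (r + m) (int r) = rq (int m) * rq (int (2 * r + 1 + m))"
      by (simp add: pair_kernel_def algebra_simps)
    thus "delta e r * phi11_term (2 * r + 1) D m =
        ((\<lambda>n. delta e n * pair_kernel n (int r)) \<circ> (\<lambda>m. r + m)) m"
      by (simp only: o_apply delta_add phi11_term_def D_def mult.assoc)
  qed
  finally have "((\<lambda>n. delta e n * pair_kernel n (int r)) has_sum
      (delta e r * (qpoch_inf D q / qpoch_inf q q))) (range (\<lambda>m. r + m))"
    by (rule has_sum_reindex[THEN iffD2, rotated]) (simp add: inj_on_def)
  also have "?this \<longleftrightarrow> ((\<lambda>n. delta e n * pair_kernel n (int r)) has_sum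
      (delta e r * (qpoch_inf D q / qpoch_inf q q))) UNIV"
  proof (rule has_sum_cong_neutral)
    fix n assume "n \<in> UNIV - range (\<lambda>m. r + m)"
    hence "n < r" by (metis DiffE le_iff_add not_le rangeI)
    thus "delta e n * pair_kernel n (int r) = 0" by (simp add: pair_kernel_def)
  qed auto
  finally show ?thesis by (simp add: D_def)
qed

definition pair_idx :: "int \<Rightarrow> nat" where
  "pair_idx r = nat (if r \<ge> 0 then r else - r - 1)"

text \<open>Replacing \<open>r\<close> by \<open>-r - 1\<close> swaps the two factors of the kernel,
  so the non-negative one of these indices suffices.\<close>

lemma pair_kernel_idx: "pair_kernel n r = pair_kernel n (int (pair_idx r))"
  by (auto simp: pair_kernel_def pair_idx_def algebra_simps)

definition pair_gamma :: "complex \<Rightarrow> int \<Rightarrow> complex" where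
  "pair_gamma e r = delta e (pair_idx r) * qpoch_inf (e * q ^ (pair_idx r + 1)) q / qpoch_inf q q"

lemma pair_kernel_sum: "((\<lambda>n. delta e n * pair_kernel n r) has_sum pair_gamma e r) UNIV"
  unfolding pair_kernel_idx[of _ r] pair_gamma_def by (rule pair_kernel_sum_nat)

section \<open>Interchanging the two summations\<close>

text \<open>Splitting \<open>1 - q powi (2 * r + 1)\<close> leaves two theta series, with arguments
  \<open>z\<close> and \<open>q ^ 2 * z\<close>.\<close>

lemma pair_coeff_abs_summable:
  assumes "z \<noteq> 0"
  shows "(\<lambda>r. norm (pair_coeff z r)) summable_on UNIV"
proof -
  have "(\<lambda>r. norm (q powi tri r * z powi r) * norm z +
      norm (q powi tri r * (q ^ 2 * z) powi r) * norm (q * z)) summable_on UNIV"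
    by (intro summable_on_add summable_on_cmult_left theta_abs_summable) (use q0 q1 assms in auto)
  thus ?thesis
  proof (rule summable_on_comparison_test)
    fix r
    have "q powi (2 * r + 1) = (q ^ 2) powi r * q"
      using q0 by (simp add: power_int_add power_int_mult)
    hence "pair_coeff z r = q powi tri r * (q ^ 2 * z) powi r * (q * z) - q powi tri r * z powi r * z"
      using assms by (simp add: pair_coeff_def power_int_add power_int_mult_distrib algebra_simps)
    also have "norm \<dots> \<le> norm (q powi tri r * (q ^ 2 * z) powi r * (q * z)) + norm (q powi tri r * z powi r * z)"
      by (rule norm_triangle_ineq4)
    finally show "norm (pair_coeff z r) \<le> norm (q powi tri r * z powi r) * norm z +
      norm (q powi tri r * (q ^ 2 * z) powi r) * norm (q * z)"
      by (simp add: norm_mult add.commute)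
  qed auto
qed

lemma delta_abs_summable: "(\<lambda>n. norm (delta e n)) summable_on UNIV"
proof -
  have "(\<lambda>n. \<Prod>j<n. norm q ^ j * (1 + norm e)) summable_on UNIV"
    by (intro summable_on_prod_power) (use q1 in auto)
  thus ?thesis
  proof (rule summable_on_comparison_test)
    fix n
    have *: "norm q ^ j \<le> 1" for j
      by (rule power_le_one) (use q1 in auto)
    show "norm (delta e n) \<le> (\<Prod>j<n. norm q ^ j * (1 + norm e))"
      unfolding delta_def prod_norm[symmetric] norm_mult norm_power
    proof (intro prod_mono conjI mult_mono)
      fix j
      show "norm q ^ (j + 1) \<le> norm q ^ j"
        using q1 by (intro power_decreasing) auto
      show "norm (q ^ (j + 1) - e) \<le> 1 + norm e"
        using norm_triangle_ineq4[of "q ^ (j + 1)" e] *[of "j + 1"] by (simp add: norm_power norm_mult)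
    qed auto
  qed auto
qed

text \<open>The kernel is bounded, so the double series over (n, r) is dominated by a product of two
  summable families. Its rows are evaluated by \<open>bailey_pair\<close>, its columns by
  \<open>pair_kernel_sum\<close>. The common value \<open>S\<close> is later identified from the
  series in \<open>r\<close>.\<close>

lemma bailey_sum:
  assumes "z \<noteq> 0"
  obtains S where "((\<lambda>r. pair_coeff z r * pair_gamma e r) has_sum S) UNIV"
    and "(\<lambda>n. delta e n * ((1 - z) * (qpoch (- 1 / z) q n * qpoch (- z) q n) / qpoch q q (2 * n))) sums S"
proof -
  obtain B where B: "B \<ge> 0" "\<And>k. norm (rq k) \<le> B" using rq_bounded by blast
  define f where "f n r = delta e n * pair_coeff z r * pair_kernel n r" for n r
  have kb: "norm (pair_kernel n r) \<le> B * B" for n r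
    unfolding pair_kernel_def norm_mult by (intro mult_mono B) (auto intro: B)
  have "(\<lambda>x. norm (case x of (n, r) \<Rightarrow> delta e n * pair_coeff z r)) summable_on UNIV \<times> UNIV"
  proof (rule summable_on_SigmaI)
    show "((\<lambda>r. norm (case (n, r) of (n, r) \<Rightarrow> delta e n * pair_coeff z r)) has_sum
        norm (delta e n) * infsum (\<lambda>r. norm (pair_coeff z r)) UNIV) UNIV" for n
      using has_sum_cmult_right[OF has_sum_infsum[OF pair_coeff_abs_summable[OF assms]]]
      by (simp add: norm_mult)
    show "(\<lambda>n. norm (delta e n) * infsum (\<lambda>r. norm (pair_coeff z r)) UNIV) summable_on UNIV"
      by (intro summable_on_cmult_left delta_abs_summable)
  qed auto
  hence "(\<lambda>x. norm (case x of (n, r) \<Rightarrow> delta e n * pair_coeff z r) * (B * B)) summable_on UNIV \<times> UNIV"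
    by (rule summable_on_cmult_left)
  hence "(\<lambda>x. norm (case x of (n, r) \<Rightarrow> f n r)) summable_on UNIV \<times> UNIV"
  proof (rule summable_on_comparison_test)
    fix x :: "nat \<times> int"
    show "norm (case x of (n, r) \<Rightarrow> f n r) \<le> norm (case x of (n, r) \<Rightarrow> delta e n * pair_coeff z r) * (B * B)"
      by (cases x) (auto simp: f_def norm_mult intro!: mult_left_mono kb[unfolded norm_mult] kb)
  qed auto
  hence "(\<lambda>(n, r). f n r) summable_on UNIV \<times> UNIV"
    by (rule abs_summable_summable)
  then obtain S where S: "((\<lambda>(n, r). f n r) has_sum S) (UNIV \<times> UNIV)"
    by (auto simp: summable_on_def)
  have rows: "((\<lambda>r. f n r) has_sum
      (delta e n * ((1 - z) * (qpoch (- 1 / z) q n * qpoch (- z) q n) / qpoch q q (2 * n)))) UNIV" for n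
    using has_sum_cmult_right[OF bailey_pair[OF assms, of n], of "delta e n"]
    by (simp add: f_def mult.assoc)
  have cols: "((\<lambda>n. f n r) has_sum (pair_coeff z r * pair_gamma e r)) UNIV" for r
    using has_sum_cmult_right[OF pair_kernel_sum[of e r], of "pair_coeff z r"]
    by (simp add: f_def mult_ac)
  have "((\<lambda>n. delta e n * ((1 - z) * (qpoch (- 1 / z) q n * qpoch (- z) q n) / qpoch q q (2 * n)))
      has_sum S) UNIV"
    by (rule has_sum_SigmaD[OF S]) (use rows in auto)
  hence 2: "(\<lambda>n. delta e n * ((1 - z) * (qpoch (- 1 / z) q n * qpoch (- z) q n) / qpoch q q (2 * n))) sums S"
    by (rule has_sum_imp_sums)
  have "((\<lambda>(r, n). f n r) has_sum S) (UNIV \<times> UNIV)"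
    using has_sum_swap[THEN iffD1, OF S] by (simp add: case_prod_unfold)
  hence "((\<lambda>r. pair_coeff z r * pair_gamma e r) has_sum S) UNIV"
    by (rule has_sum_SigmaD) (use cols in auto)
  thus ?thesis using 2 by (rule that)
qed

section \<open>The weights and column sums for e = 0, -1, 1\<close>

lemma q_choose_two: "q ^ ((n + 1) choose 2) = q powi tri (int n + 1)"
proof (induction n)
  case (Suc n)
  have "(Suc n + 1) choose 2 = ((n + 1) choose 2) + Suc n"
    by (simp add: numeral_2_eq_2)
  moreover have "q powi tri (int (Suc n) + 1) = q powi tri (int n + 1) * q ^ Suc n"
    using powi_tri_shift(1)[of "int n + 1"] power_int_of_nat[of q "Suc n"] by (simp add: add_ac)
  ultimately show ?case
    using Suc by (simp add: power_add)
qed (simp add: tri_def binomial_eq_0)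

text \<open>The exponent r(r+1)/2 is invariant under replacing \<open>r\<close> by
  \<open>-r - 1\<close>, so the case distinction in \<open>pair_idx\<close> leaves no trace.\<close>

lemma q_choose_two_idx: "q ^ ((pair_idx r + 1) choose 2) = q powi tri (r + 1)"
proof -
  have "tri (int (pair_idx r) + 1) = tri (r + 1)"
    by (auto simp: pair_idx_def tri_def algebra_simps)
  thus ?thesis by (simp only: q_choose_two)
qed

lemma delta_0: "delta 0 n = q ^ (n * (n + 1))"
proof (induction n)
  case (Suc n)
  have "Suc n * (Suc n + 1) = n * (n + 1) + ((n + 1) + (n + 1))" by simp
  thus ?case using Suc by (simp only: delta_def prod.lessThan_Suc power_add) simp
qed (simp add: delta_def)

lemma delta_minus_1: "delta (- 1) n = qpoch (- q) q n * q ^ ((n + 1) choose 2)"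
proof (induction n)
  case (Suc n)
  have "(Suc n + 1) choose 2 = ((n + 1) choose 2) + (n + 1)"
    by (simp add: numeral_2_eq_2)
  thus ?case
    using Suc by (simp only: delta_def prod.lessThan_Suc power_add qpoch_Suc) (simp add: algebra_simps)
qed (simp add: delta_def numeral_2_eq_2)

lemma delta_1: "delta 1 n = (- 1) ^ n * qpoch q q n * q ^ ((n + 1) choose 2)"
proof (induction n)
  case (Suc n)
  have "(Suc n + 1) choose 2 = ((n + 1) choose 2) + (n + 1)"
    by (simp add: numeral_2_eq_2)
  thus ?case
    using Suc by (simp only: delta_def prod.lessThan_Suc power_add qpoch_Suc) (simp add: algebra_simps)
qed (simp add: delta_def numeral_2_eq_2)

lemma pair_gamma_0: "pair_gamma 0 r = q powi (2 * tri (r + 1)) / qpoch_inf q q"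
proof -
  have "int (pair_idx r * (pair_idx r + 1)) = 2 * tri (r + 1)"
    unfolding two_tri by (auto simp: pair_idx_def algebra_simps)
  hence "q ^ (pair_idx r * (pair_idx r + 1)) = q powi (2 * tri (r + 1))"
    by (metis power_int_of_nat)
  moreover have "qpoch_inf 0 q = 1" by (simp add: qpoch_inf_def)
  ultimately show ?thesis by (simp add: pair_gamma_def delta_0)
qed

text \<open>The product (-q)_k from \<open>delta\<close> and the tail (-q^(k+1))_\<infinity>
  recombine to (-q)_\<infinity>, so that \<open>r\<close> survives only in a power of
  \<open>q\<close>.\<close>

lemma pair_gamma_minus_1: "pair_gamma (- 1) r = qpoch_inf (- q) q / qpoch_inf q q * q powi tri (r + 1)"
  using qpoch_inf_split[OF q1, of "- q" "pair_idx r"]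
  by (simp add: pair_gamma_def delta_minus_1 q_choose_two_idx[simplified])

text \<open>The recombined product is now (q)_\<infinity> and cancels the denominator. The sign is
  (-1)^r for r \<ge> 0 but (-1)^(r+1) for r < 0, which is the origin of the signed sum.\<close>

lemma pair_gamma_1: "pair_gamma 1 r = (- 1) ^ pair_idx r * q powi tri (r + 1)"
  using qpoch_inf_split[OF q1, of q "pair_idx r"] qpoch_inf_nonzero[OF q1 q1]
  by (simp add: pair_gamma_def delta_1 q_choose_two_idx[simplified])

text \<open>By tri(r) + tri(r+1) = r^2, the cases \<open>e = -1\<close> and \<open>e = 1\<close>
  lead to square exponents.\<close>

lemma pair_coeff_tri:
  assumes "z \<noteq> 0"
  shows "pair_coeff z r * q powi tri (r + 1) =
    - (q powi (r ^ 2) * (1 - q powi (2 * r + 1)) * z powi (r + 1))"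
proof -
  have "r ^ 2 = tri r + tri (r + 1)"
    using two_tri[of r] tri_add1[of r] by (simp add: power2_eq_square algebra_simps)
  hence "q powi (r ^ 2) = q powi tri r * q powi tri (r + 1)"
    using q0 by (simp add: power_int_add)
  thus ?thesis by (simp add: pair_coeff_def)
qed

end

section \<open>Theta series as infinite products in bases q^3 and q^2\<close>

text \<open>The triple product in base \<open>q ^ 3\<close>, at \<open>z * q\<close> and at
  \<open>z * q ^ 2\<close>.\<close>

lemma theta_cubic_sum:
  fixes q z :: complex
  assumes "q \<noteq> 0" "norm q < 1" "z \<noteq> 0"
  shows "((\<lambda>j. q powi (3 * tri j + j) * z powi j) has_sum
      qpochs_inf [- (q ^ 2) / z, - z * q, q ^ 3] (q ^ 3)) UNIV"
    and "((\<lambda>j. q powi (3 * tri j + 2 * j) * z powi j) has_sum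
      qpochs_inf [- q / z, - z * q ^ 2, q ^ 3] (q ^ 3)) UNIV"
proof -
  have q3: "q ^ 3 \<noteq> 0" "norm (q ^ 3) < 1"
    using assms by (auto simp: norm_power power_less_one_iff)
  have pw: "(q ^ 3) powi k = q powi (3 * k)" "(q ^ 2) powi k = q powi (2 * k)" for k
    by (simp_all add: power_int_mult)
  have "q ^ 3 / (z * q) = q ^ 2 / z" "q ^ 3 / (z * q ^ 2) = q / z"
    using assms by (simp_all add: power3_eq_cube power2_eq_square)
  thus "((\<lambda>j. q powi (3 * tri j + j) * z powi j) has_sum
      qpochs_inf [- (q ^ 2) / z, - z * q, q ^ 3] (q ^ 3)) UNIV"
    "((\<lambda>j. q powi (3 * tri j + 2 * j) * z powi j) has_sum
      qpochs_inf [- q / z, - z * q ^ 2, q ^ 3] (q ^ 3)) UNIV"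
    using jacobi_triple[OF q3, of "z * q"] jacobi_triple[OF q3, of "z * q ^ 2"] assms
    by (simp_all add: qpochs_inf_def power_int_mult_distrib pw power_int_add mult_ac)
qed

text \<open>The triple product in base \<open>q ^ 2\<close> at \<open>z * q\<close>, because j^2 = 2
  tri(j) + j.\<close>

lemma theta_square_sum:
  fixes q z :: complex
  assumes "q \<noteq> 0" "norm q < 1" "z \<noteq> 0"
  shows "((\<lambda>j. q powi (j ^ 2) * z powi j) has_sum qpochs_inf [- q / z, - z * q, q ^ 2] (q ^ 2)) UNIV"
proof -
  have q2: "q ^ 2 \<noteq> 0" "norm (q ^ 2) < 1"
    using assms by (auto simp: norm_power power_less_one_iff)
  have "(q ^ 2) powi tri j * (z * q) powi j = q powi (j ^ 2) * z powi j" for j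
  proof -
    have "j ^ 2 = 2 * tri j + j"
      unfolding two_tri by (simp add: power2_eq_square algebra_simps)
    moreover have "(q ^ 2) powi tri j = q powi (2 * tri j)"
      by (simp add: power_int_mult)
    ultimately show ?thesis
      using assms by (simp add: power_int_add power_int_mult_distrib)
  qed
  moreover have "q ^ 2 / (z * q) = q / z"
    using assms by (simp add: power2_eq_square)
  ultimately show ?thesis
    using jacobi_triple[OF q2, of "z * q"] assms
    by (simp add: qpochs_inf_def mult_ac)
qed

section \<open>The three identities\<close>

lemma first_sum:
  fixes q z :: complex
  assumes q: "q \<noteq> 0" "norm q < 1" and z: "z \<noteq> 0" "z \<noteq> 1"
  shows "(\<lambda>n. qpochs [- 1 / z, - z] q n / qpoch q q (2 * n) * q ^ (n * (n + 1))) sums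
       (1 / ((1 - z) * qpoch_inf q q) *
         (qpochs_inf [- (q ^ 2) / z, - z * q, q ^ 3] (q ^ 3)
          - z * qpochs_inf [- q / z, - z * q ^ 2, q ^ 3] (q ^ 3)))"
proof -
  define T where "T = qpochs_inf [- (q ^ 2) / z, - z * q, q ^ 3] (q ^ 3)
          - z * qpochs_inf [- q / z, - z * q ^ 2, q ^ 3] (q ^ 3)"
  obtain S where S: "((\<lambda>r. pair_coeff q z r * pair_gamma q 0 r) has_sum S) UNIV"
    "(\<lambda>n. delta q 0 n * ((1 - z) * (qpoch (- 1 / z) q n * qpoch (- z) q n) / qpoch q q (2 * n))) sums S"
    using bailey_sum[OF q z(1)] by blast
  \<comment> \<open>The two parts of \<open>1 - q powi (2 * r + 1)\<close> produce the two cubic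
    theta series; the part with q^(2r+1) is the first series at index \<open>r + 1\<close>.\<close>
  have "((\<lambda>r. (q powi (3 * tri (r + 1) + (r + 1)) * z powi (r + 1)
      - z * (q powi (3 * tri r + 2 * r) * z powi r)) / qpoch_inf q q) has_sum (T / qpoch_inf q q)) UNIV"
    unfolding T_def
    by (intro has_sum_divide_const has_sum_diff has_sum_cmult_right theta_cubic_sum
        has_sum_int_shift[of "\<lambda>r. q powi (3 * tri r + r) * z powi r"] q z)
  also have "(\<lambda>r. (q powi (3 * tri (r + 1) + (r + 1)) * z powi (r + 1)
      - z * (q powi (3 * tri r + 2 * r) * z powi r)) / qpoch_inf q q) =
      (\<lambda>r. pair_coeff q z r * pair_gamma q 0 r)"
  proof
    fix r
    have e: "3 * tri (r + 1) + (r + 1) = tri r + 2 * tri (r + 1) + (2 * r + 1)"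
      "3 * tri r + 2 * r = tri r + 2 * tri (r + 1)"
      by (simp_all add: tri_add1)
    have add: "q powi (m + n) = q powi m * q powi n" for m n
      using q by (simp add: power_int_add)
    have "z powi (r + 1) = z * z powi r"
      using z by (simp add: power_int_add)
    thus "(q powi (3 * tri (r + 1) + (r + 1)) * z powi (r + 1)
      - z * (q powi (3 * tri r + 2 * r) * z powi r)) / qpoch_inf q q = pair_coeff q z r * pair_gamma q 0 r"
      unfolding e pair_gamma_0[OF q] pair_coeff_def[OF q] add[of _ "2 * r + 1"] add[of "tri r"]
      by (simp add: algebra_simps diff_divide_distrib)
  qed
  finally have "S = T / qpoch_inf q q"
    by (rule has_sum_unique[OF S(1)])
  with sums_divide[OF S(2), of "1 - z"] show ?thesis
    using z unfolding T_def[symmetric]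
    by (simp add: delta_0[OF q] qpochs_def mult_ac)
qed

lemma second_sum:
  fixes q z :: complex
  assumes q: "q \<noteq> 0" "norm q < 1" and z: "z \<noteq> 0" "z \<noteq> 1"
  shows "(\<lambda>n. qpochs [- 1 / z, - z] q n / (qpoch q q n * qpoch q (q ^ 2) n)
         * q ^ ((n + 1) choose 2)) sums
       (qpoch_inf (- q) q / qpoch_inf q q * qpochs_inf [- q / z, - z * q, q ^ 2] (q ^ 2))"
proof -
  define T where "T = qpochs_inf [- q / z, - z * q, q ^ 2] (q ^ 2)"
  define K where "K = qpoch_inf (- q) q / qpoch_inf q q"
  obtain S where S: "((\<lambda>r. pair_coeff q z r * pair_gamma q (- 1) r) has_sum S) UNIV"
    "(\<lambda>n. delta q (- 1) n * ((1 - z) * (qpoch (- 1 / z) q n * qpoch (- z) q n) / qpoch q q (2 * n))) sums S"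
    using bailey_sum[OF q z(1)] by blast
  \<comment> \<open>As r^2 + 2r + 1 = (r+1)^2, both parts of \<open>1 - q powi (2 * r + 1)\<close>
    belong to the same theta series. This yields the factor \<open>1 - z\<close> that cancels at the
    end.\<close>
  have "((\<lambda>r. K * (q powi ((r + 1) ^ 2) * z powi (r + 1) - z * (q powi (r ^ 2) * z powi r))) has_sum
      (K * (T - z * T))) UNIV"
    unfolding T_def
    by (intro has_sum_diff has_sum_cmult_right theta_square_sum
        has_sum_int_shift[of "\<lambda>r. q powi (r ^ 2) * z powi r"] q z)
  also have "(\<lambda>r. K * (q powi ((r + 1) ^ 2) * z powi (r + 1) - z * (q powi (r ^ 2) * z powi r))) =
      (\<lambda>r. pair_coeff q z r * pair_gamma q (- 1) r)"
  proof
    fix r :: int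
    have "(r + 1) ^ 2 = r ^ 2 + (2 * r + 1)"
      by (simp add: power2_eq_square algebra_simps)
    hence "q powi ((r + 1) ^ 2) = q powi (r ^ 2) * q powi (2 * r + 1)"
      using q power_int_add[of q "r ^ 2" "2 * r + 1"] by simp
    moreover have "z powi (r + 1) = z * z powi r"
      using z by (simp add: power_int_add)
    moreover have "pair_coeff q z r * pair_gamma q (- 1) r = K * (pair_coeff q z r * q powi tri (r + 1))"
      by (simp add: pair_gamma_minus_1[OF q] K_def)
    ultimately show "K * (q powi ((r + 1) ^ 2) * z powi (r + 1) - z * (q powi (r ^ 2) * z powi r)) =
      pair_coeff q z r * pair_gamma q (- 1) r"
      unfolding pair_coeff_tri[OF q z(1)] by (simp only:) (simp add: algebra_simps)
  qed
  finally have "K * (T - z * T) = S"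
    using S(1) by (rule has_sum_unique)
  moreover have "K * (T - z * T) / (1 - z) = K * T"
    using z by (simp add: field_simps)
  ultimately have "(\<lambda>n. delta q (- 1) n * ((1 - z) * (qpoch (- 1 / z) q n * qpoch (- z) q n) / qpoch q q (2 * n))
      / (1 - z)) sums (K * T)"
    using sums_divide[OF S(2), of "1 - z"] by simp
  also have "(\<lambda>n. delta q (- 1) n * ((1 - z) * (qpoch (- 1 / z) q n * qpoch (- z) q n) / qpoch q q (2 * n))
      / (1 - z)) = (\<lambda>n. qpochs [- 1 / z, - z] q n / (qpoch q q n * qpoch q (q ^ 2) n)
         * q ^ ((n + 1) choose 2))"
  proof
    fix n
    \<comment> \<open>\<open>delta_minus_1\<close> contributes (-q)_n, which cancels against the
      same factor of (q)_(2n) in \<open>qpoch_double\<close>.\<close>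
    have "qpoch (- q) q n \<noteq> 0" using q by (intro qpoch_nonzero) auto
    thus "delta q (- 1) n * ((1 - z) * (qpoch (- 1 / z) q n * qpoch (- z) q n) / qpoch q q (2 * n))
      / (1 - z) = qpochs [- 1 / z, - z] q n / (qpoch q q n * qpoch q (q ^ 2) n)
         * q ^ ((n + 1) choose 2)"
      using z unfolding delta_minus_1[OF q] qpoch_double qpochs_def by simp
  qed
  finally show ?thesis by (simp only: K_def T_def)
qed

text \<open>No triple product enters: the bilateral summand \<open>f\<close> agrees with
  \<open>c\<close> for non-negative indices and with \<open>- c\<close> for negative ones. Its sum
  is therefore the signed sum of \<open>c\<close>, and both halves inherit summability from
  \<open>f\<close>.\<close>

lemma third_sum:
  fixes q z :: complex
  assumes q: "q \<noteq> 0" "norm q < 1" and z: "z \<noteq> 0" "z \<noteq> 1"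
  defines "c \<equiv> \<lambda>n::int. (- 1) powi (n + 1) * q powi (n ^ 2) * (1 - q powi (2 * n + 1)) * z powi (n + 1)"
  shows "signed_summable c"
    and "(\<lambda>n. (- 1) ^ n * qpochs [- 1 / z, - z] q n / (qpoch (- q) q n * qpoch q (q ^ 2) n)
         * q ^ ((n + 1) choose 2)) sums (1 / (1 - z) * signed_sum c)"
proof -
  define f where "f r = pair_coeff q z r * pair_gamma q 1 r" for r
  obtain S where S: "(f has_sum S) UNIV"
    "(\<lambda>n. delta q 1 n * ((1 - z) * (qpoch (- 1 / z) q n * qpoch (- z) q n) / qpoch q q (2 * n))) sums S"
    using bailey_sum[OF q z(1)] unfolding f_def by blast
  have f: "f r = - ((- 1) ^ pair_idx r * (q powi (r ^ 2) * (1 - q powi (2 * r + 1)) * z powi (r + 1)))" for r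
    unfolding f_def pair_gamma_1[OF q] mult.left_commute[of "pair_coeff q z r"] pair_coeff_tri[OF q z(1)]
    by simp
  have fpos: "f r = c r" if "r \<in> {0..}" for r
  proof -
    have "(- 1 :: complex) powi (r + 1) = - ((- 1) ^ pair_idx r)"
    proof -
      have "r + 1 = int (Suc (pair_idx r))"
        using that by (simp add: pair_idx_def[OF q])
      thus ?thesis by (simp only: power_int_of_nat) simp
    qed
    thus ?thesis by (simp add: f c_def)
  qed
  have fneg: "f r = - c r" if "r \<in> {..-1}" for r
  proof -
    \<comment> \<open>The exponent can be negated since -1 is its own inverse, and
      \<open>- (r + 1)\<close> is the natural number \<open>pair_idx r\<close> here.\<close>
    have "(- 1 :: complex) powi (r + 1) = (- 1) powi (- (r + 1))"
      by (simp only: power_int_minus power_int_inverse [symmetric]) simp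
    also have "\<dots> = (- 1) ^ pair_idx r"
      using that by (simp add: pair_idx_def[OF q] power_int_def)
    finally show ?thesis by (simp add: f c_def)
  qed
  have fs: "f summable_on A" for A
    by (rule summable_on_subset_banach[OF has_sum_imp_summable[OF S(1)]]) simp
  have "(\<lambda>r. - f r) summable_on {..-1}"
    unfolding summable_on_uminus by (rule fs)
  hence cneg: "c summable_on {..-1}"
    by (rule summable_on_cong[THEN iffD1, rotated]) (simp add: fneg)
  have cpos: "c summable_on {0..}"
    using fs by (rule summable_on_cong[THEN iffD1, rotated]) (simp add: fpos)
  show "signed_summable c"
    using cneg cpos by (simp add: signed_summable_def)
  have "S = infsum f UNIV"
    using S(1) by (simp add: infsumI)
  also have "(UNIV :: int set) = {0..} \<union> {..-1}" by auto
  also have "infsum f ({0..} \<union> {..-1}) = infsum f {0..} + infsum f {..-1}"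
    by (intro infsum_Un_disjoint fs) auto
  also have "infsum f {0..} = infsum c {0..}"
    by (intro infsum_cong fpos)
  also have "infsum f {..-1} = - infsum c {..-1}"
    unfolding infsum_uminus [symmetric] by (intro infsum_cong fneg)
  finally have "S = signed_sum c" by (simp add: signed_sum_def)
  with sums_divide[OF S(2), of "1 - z"]
  have "(\<lambda>n. delta q 1 n * ((1 - z) * (qpoch (- 1 / z) q n * qpoch (- z) q n) / qpoch q q (2 * n))
      / (1 - z)) sums (1 / (1 - z) * signed_sum c)" by simp
  also have "(\<lambda>n. delta q 1 n * ((1 - z) * (qpoch (- 1 / z) q n * qpoch (- z) q n) / qpoch q q (2 * n))
      / (1 - z)) = (\<lambda>n. (- 1) ^ n * qpochs [- 1 / z, - z] q n / (qpoch (- q) q n * qpoch q (q ^ 2) n)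
         * q ^ ((n + 1) choose 2))"
  proof
    fix n
    \<comment> \<open>Here the factor (q)_n of (q)_(2n) cancels, leaving (-q)_n (q;q^2)_n in the
      denominator.\<close>
    have "qpoch q q n \<noteq> 0" using q by (intro qpoch_nonzero) auto
    thus "delta q 1 n * ((1 - z) * (qpoch (- 1 / z) q n * qpoch (- z) q n) / qpoch q q (2 * n))
      / (1 - z) = (- 1) ^ n * qpochs [- 1 / z, - z] q n / (qpoch (- q) q n * qpoch q (q ^ 2) n)
         * q ^ ((n + 1) choose 2)"
      using z unfolding delta_1[OF q] qpoch_double qpochs_def by simp
  qed
  finally show "(\<lambda>n. (- 1) ^ n * qpochs [- 1 / z, - z] q n / (qpoch (- q) q n * qpoch q (q ^ 2) n)
         * q ^ ((n + 1) choose 2)) sums (1 / (1 - z) * signed_sum c)" .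
qed

theorem theorem3p6:
  fixes q z :: complex
  assumes "0 < norm q" and "norm q < 1" and "z \<noteq> 0" and "z \<noteq> 1"
  shows
    "(\<lambda>n::nat. qpochs [- 1 / z, - z] q n / qpoch q q (2 * n) * q ^ (n * (n + 1))) sums
       (1 / ((1 - z) * qpoch_inf q q) *
         (qpochs_inf [- (q ^ 2) / z, - z * q, q ^ 3] (q ^ 3)
          - z * qpochs_inf [- q / z, - z * q ^ 2, q ^ 3] (q ^ 3)))
     \<and>
     (\<lambda>n::nat. qpochs [- 1 / z, - z] q n / (qpoch q q n * qpoch q (q ^ 2) n)
         * q ^ ((n + 1) choose 2)) sums
       (qpoch_inf (- q) q / qpoch_inf q q * qpochs_inf [- q / z, - z * q, q ^ 2] (q ^ 2))
     \<and>
     signed_summable (\<lambda>n::int. (- 1) powi (n + 1) * q powi (n ^ 2)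
         * (1 - q powi (2 * n + 1)) * z powi (n + 1))
     \<and>
     (\<lambda>n::nat. (- 1) ^ n * qpochs [- 1 / z, - z] q n / (qpoch (- q) q n * qpoch q (q ^ 2) n)
         * q ^ ((n + 1) choose 2)) sums
       (1 / (1 - z) * signed_sum (\<lambda>n::int. (- 1) powi (n + 1) * q powi (n ^ 2)
         * (1 - q powi (2 * n + 1)) * z powi (n + 1)))"
proof -
  have q: "q \<noteq> 0" using assms by auto
  show ?thesis
    by (intro conjI first_sum second_sum third_sum q assms)
qed

end
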